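(* Let $N = q^k n^2$ be an odd perfect number given in Eulerian form. Then $\gcd\big(n, \sigma(q^k)/2\big) \neq 1$.
   Context: $\sigma(x)$ denotes the sum of the positive divisors of $x$. A positive integer $N$ is perfect if $\sigma(N)=2N$. An odd perfect number $N$ is said to be given in Eulerian form $N = q^k n^2$ if $q$ is a prime (the special prime), $k$ and $n$ are positive integers, $q \equiv k \equiv 1 \pmod 4$, and $\gcd(q,n)=1$. *)

theory Defs
  imports "HOL-Number_Theory.Number_Theory"
begin

definition divisor_sigma :: "nat \<Rightarrow> nat" where
  "divisor_sigma x = (\<Sum>d | d dvd x. d)"

definition perfect :: "nat \<Rightarrow> bool" where
  "perfect N \<longleftrightarrow> N > 0 \<and> divisor_sigma N = 2 * N"

definition eulerian_form :: "nat \<Rightarrow> nat \<Rightarrow> nat \<Rightarrow> nat \<Rightarrow> bool" where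
  "eulerian_form N q k n \<longleftrightarrow>
     N = q ^ k * n\<^sup>2 \<and> prime q \<and> k > 0 \<and> n > 0 \<and>
     [q = 1] (mod 4) \<and> [k = 1] (mod 4) \<and> gcd q n = 1"

(* Under the Eulerian hypotheses the truncating natural-number division
   divisor_sigma (q ^ k) div 2 is exact. *)
lemma even_divisor_sigma_special_power:
  assumes "eulerian_form N q k n"
  shows "even (divisor_sigma (q ^ k))"
proof -
  have q: "prime q" and q4: "q mod 4 = 1" and k4: "k mod 4 = 1"
    using assms by (auto simp: eulerian_form_def cong_def)
  have "odd q" "odd k"
    using q4 k4 by presburger+
  have "{d. d dvd q ^ k} = (\<lambda>i. q ^ i) ` {..k}"
    using q by (auto simp: divides_primepow_nat)
  moreover have "inj_on (\<lambda>i. q ^ i) {..k}"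
    using prime_gt_1_nat[OF q] by (auto simp: inj_on_def)
  ultimately have "divisor_sigma (q ^ k) = (\<Sum>i\<le>k. q ^ i)"
    by (simp add: divisor_sigma_def sum.reindex)
  with \<open>odd q\<close> \<open>odd k\<close> show ?thesis
    by (simp add: even_sum_iff)
qed

end

theory Submission
  imports Defs
begin

text \<open>
  By multiplicativity \<open>\<sigma>(q\<^sup>k) \<sigma>(n\<^sup>2) = 2 q\<^sup>k n\<^sup>2\<close>, and \<open>\<sigma>(q\<^sup>k) \<equiv> 1\<close> modulo \<open>q\<close> is coprime to \<open>q\<^sup>k\<close>.
  Hence \<open>\<sigma>(q\<^sup>k)/2\<close> divides \<open>n\<^sup>2\<close>; being larger than 1, it cannot be coprime to \<open>n\<close>.
\<close>

text \<open>Multiplication maps pairs of divisors of \<open>a\<close> and \<open>b\<close>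
  bijectively onto the divisors of \<open>a * b\<close>, so the product of the two sums reindexes to
  a single sum.\<close>

lemma divisor_sigma_mult_coprime:
  assumes "coprime a b"
  shows "divisor_sigma (a * b) = divisor_sigma a * divisor_sigma b"
proof -
  let ?D = "{d. d dvd a} \<times> {d. d dvd b}"
  have inj: "inj_on (\<lambda>(x, y). x * y) ?D"
  proof (rule inj_onI, clarsimp)
    fix x y x' y'
    assume d: "x dvd a" "y dvd b" "x' dvd a" "y' dvd b" and eq: "x * y = x' * y'"
    \<comment> \<open>Coprimality of \<open>a\<close> and \<open>b\<close> passes to their divisors,
      so \<open>y'\<close> can be cancelled from \<open>x dvd x' * y'\<close>, and likewise in the
      other three divisibilities.\<close>
    have "coprime x y'" "coprime x' y"
      using coprime_divisors [OF _ _ assms] d by blast+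
    moreover have "x dvd x' * y'" "y dvd y' * x'" "x' dvd x * y" "y' dvd y * x"
      using eq by (metis dvd_triv_left dvd_triv_right mult.commute)+
    ultimately have "x dvd x'" "x' dvd x" "y dvd y'" "y' dvd y"
      by (simp_all add: coprime_dvd_mult_left_iff coprime_commute)
    then show "x = x' \<and> y = y'"
      by (simp add: dvd_antisym)
  qed
  have img: "(\<lambda>(x, y). x * y) ` ?D = {d. d dvd a * b}"
    by (auto simp: image_iff intro: mult_dvd_mono dest: division_decomp)
  have "divisor_sigma a * divisor_sigma b = (\<Sum>(x, y)\<in>?D. x * y)"
    by (simp add: divisor_sigma_def sum_product sum.cartesian_product)
  also have "\<dots> = divisor_sigma (a * b)"
    unfolding divisor_sigma_def img [symmetric] by (subst sum.reindex [OF inj]) (simp add: comp_def case_prod_unfold)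
  finally show ?thesis ..
qed

lemma divisor_sigma_prime_power:
  assumes "prime q"
  shows "divisor_sigma (q ^ k) = (\<Sum>i\<le>k. q ^ i)"
proof -
  have "{d. d dvd q ^ k} = (\<lambda>i. q ^ i) ` {..k}"
    using assms by (auto simp: divides_primepow_nat)
  moreover have "inj_on (\<lambda>i. q ^ i) {..k}"
    using prime_gt_1_nat [OF assms] by (auto simp: inj_on_def)
  ultimately show ?thesis
    by (simp add: divisor_sigma_def sum.reindex)
qed

lemma coprime_divisor_sigma_prime_power:
  assumes "prime q"
  shows "coprime (divisor_sigma (q ^ k)) (q ^ k)"
proof -
  \<comment> \<open>Only the term for exponent 0 is not a multiple of \<open>q\<close>.\<close>
  have "divisor_sigma (q ^ k) = 1 + q * (\<Sum>i<k. q ^ i)"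
    unfolding divisor_sigma_prime_power [OF assms]
    by (simp add: sum.atMost_shift sum_distrib_left)
  then have "\<not> q dvd divisor_sigma (q ^ k)"
    using assms by (metis dvd_add_left_iff dvd_triv_left not_prime_unit)
  then show ?thesis
    using assms by (simp add: coprime_commute prime_imp_coprime)
qed

theorem theorem6:
  fixes N q k n :: nat
  assumes "odd N"
    and "perfect N"
    and "eulerian_form N q k n"
  shows "gcd n (divisor_sigma (q ^ k) div 2) \<noteq> 1"
proof
  assume gcd1: "gcd n (divisor_sigma (q ^ k) div 2) = 1"
  have q: "prime q" and N: "N = q ^ k * n\<^sup>2" and "k > 0" and "coprime q n"
    using assms(3) unfolding eulerian_form_def coprime_iff_gcd_eq_1 by simp_all
  obtain h where h: "divisor_sigma (q ^ k) = 2 * h"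
    using even_divisor_sigma_special_power [OF assms(3)] by (elim evenE)
  have "divisor_sigma (q ^ k) * divisor_sigma (n\<^sup>2) = 2 * (q ^ k * n\<^sup>2)"
    using assms(2) \<open>coprime q n\<close> unfolding perfect_def N
    by (simp add: divisor_sigma_mult_coprime)
  then have "h * divisor_sigma (n\<^sup>2) = q ^ k * n\<^sup>2"
    by (simp add: h)
  then have "h dvd q ^ k * n\<^sup>2"
    by (metis dvd_triv_left)
  moreover have "coprime h (q ^ k)"
    using coprime_divisor_sigma_prime_power [OF q, of k] unfolding h by auto
  ultimately have "h dvd n\<^sup>2"
    by (simp add: coprime_dvd_mult_right_iff)
  moreover have "coprime h (n\<^sup>2)"
    using gcd1 unfolding coprime_iff_gcd_eq_1 [symmetric] by (simp add: h coprime_commute)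
  \<comment> \<open>\<open>h\<close> is itself a common divisor of the coprime pair \<open>h\<close>
    and \<open>n\<^sup>2\<close>.\<close>
  ultimately have "h = 1"
    using coprime_common_divisor [of h "n\<^sup>2" h] by simp
  \<comment> \<open>As \<open>k > 0\<close>, the exponents 0 and \<open>k\<close> are distinct, so
    the sum on the left is \<open>1 + q ^ k\<close>. With \<open>h = 1\<close> the right side is 2,
    which contradicts \<open>q ^ k > 1\<close>.\<close>
  moreover have "(\<Sum>i\<in>{0, k}. q ^ i) \<le> divisor_sigma (q ^ k)"
    unfolding divisor_sigma_prime_power [OF q] by (intro sum_mono2) auto
  moreover have "q ^ k > 1"
    using prime_gt_1_nat [OF q] \<open>k > 0\<close> by (rule one_less_power)
  ultimately show False
    using \<open>k > 0\<close> by (simp add: h)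
qed

end
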